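(* Assume the standing setup (A1)--(A5). Then, given $\mathcal H_t$, $$\pi_{\tau,t}\Longrightarrow\mathrm{Law}\left(\theta^\star_{f_t}\mid f_t\sim\mathbb P_t\right)\qquad\text{as }\tau\downarrow0$$ (weak convergence of probability laws on $\Omega$), where $\theta^\star_{f_t}=\arg\max_{\theta\in\Omega}f_t(\theta)$.
   Context: Standing setup. $d\ge1$ is fixed, $\lambda$ is Lebesgue measure, $\mathbb B(\theta,r)$ is the open Euclidean ball. (A1) $\Omega\subset\mathbb R^d$ is compact, convex, with nonempty interior, and there are $c_\Omega,r_\Omega>0$ with $\lambda\{\mathbb B(\theta,r)\cap\Omega\}\ge c_\Omega r^d$ for all $\theta\in\Omega$, $0<r\le r_\Omega$. (A2) $f\sim\mathcal{GP}(0,\kappa)$ on $\Omega$ with $\kappa$ positive definite. Responses are $y_i=f(\theta_i)+\varepsilon_i$, $\varepsilon_i$ iid $\mathcal N(0,\varsigma^2)$, independent of $f$ and of the algorithmic randomness. $\kappa$ and $\varsigma^2\ge0$ are fixed and known and Gaussian-process (GP) updating is exact; if $\varsigma^2=0$, redundant observations are removed before conditioning. Sequential design: after a finite initial design $\mathcal D_0$ (possibly empty), active queries $\theta_1,\theta_2,\dots$ are made one at a time; $\mathcal D_t$ consists of $\mathcal D_0$ and the first $t$ active pairs $(\theta_i,y_i)$, and $\mathcal H_t=\sigma(\mathcal D_t)$. $\mathbb P_t$ is the conditional law of $f$ given $\mathcal H_t$, a GP with mean $\mu_t$ and covariance $\kappa_t$. (A3) The next query $\theta_{t+1}$ is measurable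 with respect to $\mathcal H_t$ and fresh algorithmic randomness independent of $f$, of the noises and of earlier algorithmic randomness. Conditionally on $\mathcal H_t$, $f$ and a posterior draw $f_t$ are iid from $\mathbb P_t$. (A4) For every $t$, $f_t$ has a unique maximiser over $\Omega$, $\mathbb P_t$-a.s. (A5) For some open $U\supset\Omega$, $\kappa$ extends to a covariance kernel on $U\times U$, $B_\kappa:=\sup_{\theta\in\Omega}\kappa(\theta,\theta)\in(0,\infty)$, and the prior GP on $U$ has a version with $C^1(U)$ sample paths a.s. With $\mathscr d_0^2(\theta,\theta')=\mathrm{Var}\{f(\theta)-f(\theta')\}$, $\mathscr d_{0,j}^2(\theta,\theta')=\mathrm{Var}\{\partial_jf(\theta)-\partial_jf(\theta')\}$ and $N(\epsilon,\Omega,\mathscr d)$ the covering number, $J_0=\int_0^{\mathrm{diam}(\Omega,\mathscr d_0)}\sqrt{\log N(\epsilon,\Omega,\mathscr d_0)}\,d\epsilon<\infty$ and $J_0^{(j)}=\int_0^{\mathrm{diam}(\Omega,\mathscr d_{0,j})}\sqrt{\log N(\epsilon,\Omega,\mathscr d_{0,j})}\,d\epsilon<\infty$, and $B_{\partial,j}=\sup_{\theta\in\Omega}\mathrm{Var}\{\partial_jf(\theta)\}<\infty$, for $1\le j\le d$. For every $t$, a.s., $\mu_t\in C^1(U)$ and $\partial_j\mu_t(\theta)=\mathbb E\{\partial_jf(\theta)\mid\mathcal H_t\}$ for all $\theta\in\Omega$, $1\le j\le d$. Annealed objective. For $g\in C(\Omega)$ and $\tau\in(0,1]$, $\pi_\tau(d\theta\mid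 g)=\exp\{g(\theta)/\tau\}\lambda(d\theta)/\int_\Omega\exp\{g(u)/\tau\}\lambda(du)$, and $\pi_{\tau,t}(d\theta)=\mathbb E_{f_t\sim\mathbb P_t}\{\pi_\tau(d\theta\mid f_t)\}$. *)

theory Defs
  imports "HOL-Probability.Probability"
begin

section \<open>Gaussian processes\<close>

(* N(m, v) with variance v \<ge> 0; v = 0 is the point mass at m. *)
definition gaussian_law :: "real \<Rightarrow> real \<Rightarrow> real measure" where
  "gaussian_law m v =
     (if v = 0 then return borel m else density lborel (normal_density m (sqrt v)))"

definition covariance_kernel :: "'a set \<Rightarrow> ('a \<Rightarrow> 'a \<Rightarrow> real) \<Rightarrow> bool" where
  "covariance_kernel T k \<longleftrightarrow>
     (\<forall>x\<in>T. \<forall>y\<in>T. k x y = k y x) \<and>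
     (\<forall>F c. finite F \<longrightarrow> F \<subseteq> T \<longrightarrow> (\<Sum>x\<in>F. \<Sum>y\<in>F. c x * c y * k x y) \<ge> 0)"

definition positive_definite_kernel :: "'a set \<Rightarrow> ('a \<Rightarrow> 'a \<Rightarrow> real) \<Rightarrow> bool" where
  "positive_definite_kernel T k \<longleftrightarrow>
     (\<forall>x\<in>T. \<forall>y\<in>T. k x y = k y x) \<and>
     (\<forall>F c. finite F \<longrightarrow> F \<subseteq> T \<longrightarrow> (\<exists>x\<in>F. c x \<noteq> 0) \<longrightarrow>
        (\<Sum>x\<in>F. \<Sum>y\<in>F. c x * c y * k x y) > 0)"

(* Joint Gaussianity of the finite-dimensional distributions is expressed by
   Gaussianity of all finite linear combinations. *)
definition gaussian_process ::
  "'w measure \<Rightarrow> ('w \<Rightarrow> 'a \<Rightarrow> real) \<Rightarrow> 'a set \<Rightarrow> ('a \<Rightarrow> real) \<Rightarrow> ('a \<Rightarrow> 'a \<Rightarrow> real) \<Rightarrow> bool" where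
  "gaussian_process M X T m k \<longleftrightarrow>
     covariance_kernel T k \<and>
     (\<forall>x\<in>T. (\<lambda>w. X w x) \<in> borel_measurable M) \<and>
     (\<forall>F c. finite F \<longrightarrow> F \<subseteq> T \<longrightarrow>
        distr M borel (\<lambda>w. \<Sum>x\<in>F. c x * X w x) =
        gaussian_law (\<Sum>x\<in>F. c x * m x) (\<Sum>x\<in>F. \<Sum>y\<in>F. c x * c y * k x y))"

section \<open>Continuously differentiable paths\<close>

definition C1_on :: "'a::euclidean_space set \<Rightarrow> ('a \<Rightarrow> real) \<Rightarrow> bool" where
  "C1_on U g \<longleftrightarrow> (\<exists>D. continuous_on U D \<and> (\<forall>x\<in>U. GDERIV g x :> D x))"

definition partial_deriv :: "'a::euclidean_space \<Rightarrow> ('a \<Rightarrow> real) \<Rightarrow> 'a \<Rightarrow> real" where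
  "partial_deriv b g x = deriv (\<lambda>s. g (x + s *\<^sub>R b)) 0"

(* The space C^1(U) with the sigma-algebra generated by the point evaluations.
   The unrestricted product space would not do: there neither the set of
   continuous functions nor the maximiser is measurable. *)
definition C1_paths :: "'a::euclidean_space set \<Rightarrow> ('a \<Rightarrow> real) measure" where
  "C1_paths U = restrict_space (\<Pi>\<^sub>M x\<in>U. borel) {g. C1_on U g}"

(* A law on C^1(U), regarded as a law on the product space. *)
definition product_law :: "'a set \<Rightarrow> ('a \<Rightarrow> real) measure \<Rightarrow> ('a \<Rightarrow> real) measure" where
  "product_law U N = distr N (\<Pi>\<^sub>M x\<in>U. borel) (\<lambda>g. g)"

section \<open>Metric entropy\<close>

(* Infinite if there is no finite cover. *)
definition covering_number :: "real \<Rightarrow> 'a set \<Rightarrow> ('a \<Rightarrow> 'a \<Rightarrow> real) \<Rightarrow> enat" where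
  "covering_number e S d =
     Inf {enat (card C) | C. finite C \<and> C \<subseteq> S \<and> (\<forall>x\<in>S. \<exists>c\<in>C. d c x \<le> e)}"

definition sqrt_log :: "enat \<Rightarrow> ennreal" where
  "sqrt_log N = (case N of enat n \<Rightarrow> ennreal (sqrt (ln (real n))) | \<infinity> \<Rightarrow> \<infinity>)"

definition pseudo_diameter :: "'a set \<Rightarrow> ('a \<Rightarrow> 'a \<Rightarrow> real) \<Rightarrow> ennreal" where
  "pseudo_diameter S d = (SUP x\<in>S. SUP y\<in>S. ennreal (d x y))"

definition entropy_integral :: "'a set \<Rightarrow> ('a \<Rightarrow> 'a \<Rightarrow> real) \<Rightarrow> ennreal" where
  "entropy_integral S d =
     (\<integral>\<^sup>+e\<in>{e. 0 < e \<and> ennreal e \<le> pseudo_diameter S d}.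
        sqrt_log (covering_number e S d) \<partial>lborel)"

section \<open>Conditional laws\<close>

(* K is a regular conditional law, given the sub-sigma-algebra F of M, of the
   random element X of S. *)
definition regular_cond_law ::
  "'w measure \<Rightarrow> 'w measure \<Rightarrow> 'b measure \<Rightarrow> ('w \<Rightarrow> 'b) \<Rightarrow> ('w \<Rightarrow> 'b measure) \<Rightarrow> bool" where
  "regular_cond_law M F S X K \<longleftrightarrow>
     K \<in> F \<rightarrow>\<^sub>M prob_algebra S \<and> X \<in> M \<rightarrow>\<^sub>M S \<and>
     (\<forall>A\<in>sets F. \<forall>B\<in>sets S.
        emeasure M {w\<in>A. X w \<in> B} = (\<integral>\<^sup>+w\<in>A. emeasure (K w) B \<partial>M))"

definition path_mean :: "('a \<Rightarrow> real) measure \<Rightarrow> 'a \<Rightarrow> real" where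
  "path_mean N x = (\<integral>g. g x \<partial>N)"

definition path_cov :: "('a \<Rightarrow> real) measure \<Rightarrow> 'a \<Rightarrow> 'a \<Rightarrow> real" where
  "path_cov N x y = (\<integral>g. (g x - path_mean N x) * (g y - path_mean N y) \<partial>N)"

section \<open>Sequential design\<close>

(* The first n pairs (location, response). *)
definition design_data ::
  "('w \<Rightarrow> 'a \<Rightarrow> real) \<Rightarrow> (nat \<Rightarrow> 'w \<Rightarrow> real) \<Rightarrow> (nat \<Rightarrow> 'w \<Rightarrow> 'a) \<Rightarrow> nat \<Rightarrow> 'w \<Rightarrow> nat \<Rightarrow> 'a \<times> real" where
  "design_data f noise q n w = (\<lambda>i\<in>{..<n}. (q i w, f w (q i w) + noise i w))"

abbreviation data_space :: "nat \<Rightarrow> (nat \<Rightarrow> 'a::euclidean_space \<times> real) measure" where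
  "data_space n \<equiv> \<Pi>\<^sub>M i\<in>{..<n}. borel"

definition history ::
  "'w measure \<Rightarrow> ('w \<Rightarrow> 'a::euclidean_space \<Rightarrow> real) \<Rightarrow> (nat \<Rightarrow> 'w \<Rightarrow> real) \<Rightarrow>
   (nat \<Rightarrow> 'w \<Rightarrow> 'a) \<Rightarrow> nat \<Rightarrow> 'w measure" where
  "history M f noise q n = vimage_algebra (space M) (design_data f noise q n) (data_space n)"

datatype source = Path | Noise nat | Algo nat

(* Observations are indexed consecutively: 0, ..., n0 - 1 form the initial design,
   n0 + t is the active query number t + 1, and the history at time t is generated
   by the first n0 + t pairs.  The algorithmic randomness xi 0 is that of the
   initial design (deterministic initial locations are a special case); xi (t + 1)
   is the one used for the active query number t + 1.

   f is the version of the prior process on U with almost surely C^1 paths, and Df is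
   a measurable version of its gradient.  Sample paths being regular only almost surely,
   the pointwise derivative of f need not itself be measurable when M is not complete.

   draw t is the posterior draw at time t, and P t the posterior law.  Conditional
   expectations of path functionals given the history are integrals against P t w, which
   makes "almost surely, for all theta" in mean_C1 independent of the choice of versions.
   For noise_var = 0, removing redundant (repeated) observations does not change the
   conditional law, so the history is generated by the full data. *)
locale gp_sequential_design = prob_space M
  for M :: "'w measure" +
  fixes \<Omega> U :: "'a::euclidean_space set"
    and \<kappa> :: "'a \<Rightarrow> 'a \<Rightarrow> real"
    and noise_var :: real
    and f :: "'w \<Rightarrow> 'a \<Rightarrow> real"
    and Df :: "'w \<Rightarrow> 'a \<Rightarrow> 'a"
    and noise :: "nat \<Rightarrow> 'w \<Rightarrow> real"
    and R :: "nat \<Rightarrow> 'r measure"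
    and xi :: "nat \<Rightarrow> 'w \<Rightarrow> 'r"
    and n0 :: nat
    and q :: "nat \<Rightarrow> 'w \<Rightarrow> 'a"
    and draw :: "nat \<Rightarrow> 'w \<Rightarrow> 'a \<Rightarrow> real"
    and P :: "nat \<Rightarrow> 'w \<Rightarrow> ('a \<Rightarrow> real) measure"
  assumes domain: "compact \<Omega>" "convex \<Omega>" "interior \<Omega> \<noteq> {}"
    and domain_volume: "\<exists>c>0. \<exists>r0>0. \<forall>\<theta>\<in>\<Omega>. \<forall>r. 0 < r \<and> r \<le> r0 \<longrightarrow>
          measure lborel (ball \<theta> r \<inter> \<Omega>) \<ge> c * r ^ DIM('a)"
    and kernel_pd: "positive_definite_kernel \<Omega> \<kappa>"
    and U: "open U" "\<Omega> \<subseteq> U"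
    and prior: "gaussian_process M f U (\<lambda>_. 0) \<kappa>"
    and noise_var: "noise_var \<ge> 0"
    and noise: "\<And>i. random_variable borel (noise i)"
          "\<And>i. distr M borel (noise i) = gaussian_law 0 noise_var"
    and xi: "\<And>i. random_variable (R i) (xi i)"
    and independence: "indep_sets (\<lambda>s. case s of
            Path \<Rightarrow> sets (vimage_algebra (space M) (\<lambda>w. restrict (f w) U) (\<Pi>\<^sub>M x\<in>U. borel))
          | Noise i \<Rightarrow> sets (vimage_algebra (space M) (noise i) borel)
          | Algo i \<Rightarrow> sets (vimage_algebra (space M) (xi i) (R i))) UNIV"
    and query_domain: "\<And>i w. w \<in> space M \<Longrightarrow> q i w \<in> \<Omega>"
    and response: "\<And>i. random_variable borel (\<lambda>w. f w (q i w) + noise i w)"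
    and initial_query: "\<And>i. i < n0 \<Longrightarrow> q i \<in> vimage_algebra (space M) (xi 0) (R 0) \<rightarrow>\<^sub>M borel"
    and active_query: "\<And>t. q (n0 + t) \<in>
          vimage_algebra (space M) (\<lambda>w. (design_data f noise q (n0 + t) w, xi (Suc t) w))
            (data_space (n0 + t) \<Otimes>\<^sub>M R (Suc t)) \<rightarrow>\<^sub>M borel"
    and posterior_kernel:
          "\<And>t. P t \<in> history M f noise q (n0 + t) \<rightarrow>\<^sub>M prob_algebra (C1_paths U)"
    and posterior: "\<And>t. regular_cond_law M (history M f noise q (n0 + t)) (\<Pi>\<^sub>M x\<in>U. borel)
          (\<lambda>w. restrict (f w) U) (\<lambda>w. product_law U (P t w))"
    and posterior_gp: "\<And>t. AE w in M.
          gaussian_process (P t w) (\<lambda>g. g) U (path_mean (P t w)) (path_cov (P t w))"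
    and posterior_draw: "\<And>t. regular_cond_law M (history M f noise q (n0 + t))
          ((\<Pi>\<^sub>M x\<in>U. borel) \<Otimes>\<^sub>M (\<Pi>\<^sub>M x\<in>U. borel))
          (\<lambda>w. (restrict (f w) U, restrict (draw t w) U))
          (\<lambda>w. product_law U (P t w) \<Otimes>\<^sub>M product_law U (P t w))"
    and unique_maximiser: "\<And>t. AE w in M. AE g in P t w. \<exists>!\<theta>. is_arg_max g (\<lambda>x. x \<in> \<Omega>) \<theta>"
    and kernel_bound: "bdd_above ((\<lambda>\<theta>. \<kappa> \<theta> \<theta>) ` \<Omega>)" "0 < (SUP \<theta>\<in>\<Omega>. \<kappa> \<theta> \<theta>)"
    and gradient_measurable: "\<And>\<theta>. \<theta> \<in> U \<Longrightarrow> random_variable borel (\<lambda>w. Df w \<theta>)"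
    and prior_C1: "AE w in M. continuous_on U (Df w) \<and> (\<forall>\<theta>\<in>U. GDERIV (f w) \<theta> :> Df w \<theta>)"
    and entropy: "entropy_integral \<Omega> (\<lambda>\<theta> \<theta>'. sqrt (variance (\<lambda>w. f w \<theta> - f w \<theta>'))) < \<infinity>"
    and entropy_deriv: "\<And>b. b \<in> Basis \<Longrightarrow>
          entropy_integral \<Omega> (\<lambda>\<theta> \<theta>'. sqrt (variance (\<lambda>w. Df w \<theta> \<bullet> b - Df w \<theta>' \<bullet> b))) < \<infinity>"
    and deriv_bound: "\<And>b. b \<in> Basis \<Longrightarrow> bdd_above ((\<lambda>\<theta>. variance (\<lambda>w. Df w \<theta> \<bullet> b)) ` \<Omega>)"
    and mean_C1: "\<And>t. AE w in M. C1_on U (path_mean (P t w)) \<and>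
          (\<forall>\<theta>\<in>\<Omega>. \<forall>b\<in>Basis.
             partial_deriv b (path_mean (P t w)) \<theta> = (\<integral>g. partial_deriv b g \<theta> \<partial>P t w))"

section \<open>Annealed objective and maximisers\<close>

definition gibbs :: "'a::euclidean_space set \<Rightarrow> real \<Rightarrow> ('a \<Rightarrow> real) \<Rightarrow> 'a measure" where
  "gibbs \<Omega> \<tau> g = density (restrict_space lborel \<Omega>)
     (\<lambda>\<theta>. ennreal (exp (g \<theta> / \<tau>) / (LINT u:\<Omega>|lborel. exp (g u / \<tau>))))"

definition annealed_law ::
  "'a::euclidean_space set \<Rightarrow> real \<Rightarrow> ('a \<Rightarrow> real) measure \<Rightarrow> 'a measure" where
  "annealed_law \<Omega> \<tau> N = N \<bind> gibbs \<Omega> \<tau>"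

(* The fixed default value, used where the maximiser is not unique, keeps the map measurable. *)
definition maximiser :: "'a set \<Rightarrow> ('a \<Rightarrow> real) \<Rightarrow> 'a" where
  "maximiser \<Omega> g =
     (if \<exists>!x. is_arg_max g (\<lambda>x. x \<in> \<Omega>) x then arg_max_on g \<Omega> else (SOME x. x \<in> \<Omega>))"

definition maximiser_law ::
  "'a::euclidean_space set \<Rightarrow> ('a \<Rightarrow> real) measure \<Rightarrow> 'a measure" where
  "maximiser_law \<Omega> N = distr N (restrict_space borel \<Omega>) (maximiser \<Omega>)"

(* Weak convergence, along a filter, of Borel probability laws on S. *)
definition weak_conv_on ::
  "'a::topological_space set \<Rightarrow> ('i \<Rightarrow> 'a measure) \<Rightarrow> 'a measure \<Rightarrow> 'i filter \<Rightarrow> bool" where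
  "weak_conv_on S N L F \<longleftrightarrow>
     (\<forall>\<^sub>F i in F. N i \<in> space (prob_algebra (restrict_space borel S))) \<and>
     L \<in> space (prob_algebra (restrict_space borel S)) \<and>
     (\<forall>h::'a \<Rightarrow> real. continuous_on S h \<longrightarrow> bounded (h ` S) \<longrightarrow>
        ((\<lambda>i. \<integral>x. h x \<partial>N i) \<longlongrightarrow> (\<integral>x. h x \<partial>L)) F)"

end

theory Submission
  imports Defs
begin

text \<open>
  For a continuous function with a unique maximiser on a compact set all of whose relative balls
  have positive volume, Laplace's method shows that the Gibbs measures concentrate at the
  maximiser.  Integrating the resulting convergence of the integrals of a bounded test function
  over the posterior law of the path, by dominated convergence, gives the weak convergence of the
  annealed laws.  Both the Gibbs kernel and the maximiser are measurable in the path because a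
  continuous path is determined by its values on a countable dense set.
\<close>

section \<open>Gibbs measures of continuous functions\<close>

text \<open>Positive volume of every relative ball is the form in which (A1) enters: it keeps the
  normalising constants positive and bounds them from below near a maximiser.\<close>

locale positive_volume_domain =
  fixes \<Omega> :: "'a::euclidean_space set"
  assumes compact: "compact \<Omega>"
    and nonempty: "\<Omega> \<noteq> {}"
    and volume: "\<And>x r. x \<in> \<Omega> \<Longrightarrow> 0 < r \<Longrightarrow> 0 < measure lborel (ball x r \<inter> \<Omega>)"
begin

abbreviation L :: "'a measure" where
  "L \<equiv> restrict_space lborel \<Omega>"

lemma domain_sets [measurable, simp]: "\<Omega> \<in> sets borel"
  using compact by (simp add: borel_compact)

lemma space_L [simp]: "space L = \<Omega>"
  by (simp add: space_restrict_space)

lemma sets_L [simp, measurable_cong]: "sets L = sets (restrict_space borel \<Omega>)"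
  by (simp add: sets_restrict_space)

lemma domain_in_sets_L [simp]: "\<Omega> \<in> sets (restrict_space borel \<Omega>)"
  using sets.top[of L] by simp

lemma finite_measure_L: "finite_measure L"
proof
  show "emeasure L (space L) \<noteq> \<infinity>"
    using emeasure_bounded_finite[OF compact_imp_bounded[OF compact]]
    by (simp add: emeasure_restrict_space top.not_eq_extremum)
qed

lemma borel_measurable_continuous_L: "continuous_on \<Omega> h \<Longrightarrow> h \<in> borel_measurable L"
  using borel_measurable_continuous_on_restrict[of \<Omega> h] by (simp cong: measurable_cong_sets)

lemma bounded_continuous:
  fixes h :: "'a \<Rightarrow> real"
  assumes "continuous_on \<Omega> h"
  obtains B where "0 < B" "\<And>x. x \<in> \<Omega> \<Longrightarrow> \<bar>h x\<bar> \<le> B"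
proof -
  have "bounded (h ` \<Omega>)"
    using compact_continuous_image[OF assms compact] by (rule compact_imp_bounded)
  then obtain B where "0 < B" "\<forall>y\<in>h ` \<Omega>. norm y \<le> B"
    unfolding bounded_pos by blast
  then show thesis using that by auto
qed

lemma integrable_continuous_L:
  fixes h :: "'a \<Rightarrow> real"
  assumes "continuous_on \<Omega> h"
  shows "integrable L h"
proof -
  interpret finite_measure L by (rule finite_measure_L)
  obtain B where "\<And>x. x \<in> \<Omega> \<Longrightarrow> \<bar>h x\<bar> \<le> B"
    using bounded_continuous[OF assms] by blast
  then show ?thesis
    by (intro integrable_const_bound[where B=B] AE_I2 borel_measurable_continuous_L assms) auto
qed

section \<open>The normalising constant and the Gibbs laws\<close>

definition partition_function :: "real \<Rightarrow> ('a \<Rightarrow> real) \<Rightarrow> real" where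
  "partition_function \<tau> g = (\<integral>u. exp (g u / \<tau>) \<partial>L)"

lemma continuous_gibbs_weight:
  fixes g :: "'a \<Rightarrow> real"
  shows "continuous_on \<Omega> g \<Longrightarrow> continuous_on \<Omega> (\<lambda>x. exp (g x / \<tau>))"
  unfolding divide_inverse by (intro continuous_intros)

text \<open>The integrand is positive, so the integral may be cut down to a ball, where the
  integrand is at least \<open>exp (m / \<tau>)\<close>. A unit ball yields positivity; a small ball
  at the maximiser yields the rate in Laplace's method.\<close>

lemma partition_function_lower_bound:
  assumes g: "continuous_on \<Omega> g" and "0 < \<tau>"
    and le: "\<And>y. y \<in> ball x r \<inter> \<Omega> \<Longrightarrow> m \<le> g y"
  shows "measure lborel (ball x r \<inter> \<Omega>) * exp (m / \<tau>) \<le> partition_function \<tau> g"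
proof -
  interpret finite_measure L by (rule finite_measure_L)
  have B: "ball x r \<inter> \<Omega> \<in> sets L"
    by (auto simp: sets_restrict_space)
  have "measure lborel (ball x r \<inter> \<Omega>) * exp (m / \<tau>)
      = (\<integral>u. indicator (ball x r \<inter> \<Omega>) u * exp (m / \<tau>) \<partial>L)"
    using B by (simp add: measure_restrict_space)
  also have "\<dots> \<le> partition_function \<tau> g"
    unfolding partition_function_def
  proof (rule integral_mono)
    show "integrable L (\<lambda>u. indicator (ball x r \<inter> \<Omega>) u * exp (m / \<tau>))"
      using B by (intro integrable_mult_left integrable_real_indicator) (auto simp: emeasure_eq_measure)
    show "integrable L (\<lambda>u. exp (g u / \<tau>))"
      by (intro integrable_continuous_L continuous_gibbs_weight g)
    show "indicator (ball x r \<inter> \<Omega>) u * exp (m / \<tau>) \<le> exp (g u / \<tau>)" for u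
      using le[of u] \<open>0 < \<tau>\<close> by (auto simp: indicator_def divide_right_mono)
  qed
  finally show ?thesis .
qed

lemma partition_function_pos:
  assumes "continuous_on \<Omega> g" and "0 < \<tau>"
  shows "0 < partition_function \<tau> g"
proof -
  obtain x where "x \<in> \<Omega>" using nonempty by blast
  obtain B where "\<And>y. y \<in> \<Omega> \<Longrightarrow> \<bar>g y\<bar> \<le> B"
    using bounded_continuous[OF assms(1)] by blast
  then have "\<And>y. y \<in> ball x 1 \<inter> \<Omega> \<Longrightarrow> - B \<le> g y" by fastforce
  then have "measure lborel (ball x 1 \<inter> \<Omega>) * exp (- B / \<tau>) \<le> partition_function \<tau> g"
    by (intro partition_function_lower_bound assms)
  moreover have "0 < measure lborel (ball x 1 \<inter> \<Omega>) * exp (- B / \<tau>)"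
    using volume[OF \<open>x \<in> \<Omega>\<close>] by simp
  ultimately show ?thesis by linarith
qed

lemma gibbs_eq_density:
  "gibbs \<Omega> \<tau> g = density L (\<lambda>x. ennreal (exp (g x / \<tau>) / partition_function \<tau> g))"
  by (simp add: gibbs_def partition_function_def integral_restrict_space set_lebesgue_integral_def)

lemma sets_gibbs [simp, measurable_cong]: "sets (gibbs \<Omega> \<tau> g) = sets (restrict_space borel \<Omega>)"
  by (simp add: gibbs_eq_density)

lemma integral_gibbs:
  fixes h :: "'a \<Rightarrow> real"
  assumes g: "continuous_on \<Omega> g" and "0 < \<tau>" and h: "continuous_on \<Omega> h"
  shows "(\<integral>x. h x \<partial>gibbs \<Omega> \<tau> g) = (\<integral>x. exp (g x / \<tau>) / partition_function \<tau> g * h x \<partial>L)"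
proof -
  have [measurable]: "h \<in> borel_measurable L" "(\<lambda>x. exp (g x / \<tau>)) \<in> borel_measurable L"
    using borel_measurable_continuous_L[OF h]
      borel_measurable_continuous_L[OF continuous_gibbs_weight[OF g]] by auto
  show ?thesis
    unfolding gibbs_eq_density
    using partition_function_pos[OF g \<open>0 < \<tau>\<close>]
    by (subst integral_density) (auto simp: less_imp_le)
qed

lemma prob_space_gibbs:
  assumes g: "continuous_on \<Omega> g" and "0 < \<tau>"
  shows "prob_space (gibbs \<Omega> \<tau> g)"
proof
  have w [measurable]: "(\<lambda>x. exp (g x / \<tau>)) \<in> borel_measurable L"
    and i: "integrable L (\<lambda>x. exp (g x / \<tau>))"
    using borel_measurable_continuous_L integrable_continuous_L continuous_gibbs_weight[OF g]
    by blast+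
  have Z: "0 < partition_function \<tau> g"
    by (rule partition_function_pos[OF assms])
  have "emeasure (gibbs \<Omega> \<tau> g) (space (gibbs \<Omega> \<tau> g))
      = (\<integral>\<^sup>+x. ennreal (exp (g x / \<tau>) / partition_function \<tau> g) \<partial>L)"
    unfolding gibbs_eq_density space_density
    by (subst emeasure_density) (auto intro!: nn_integral_cong)
  also have "\<dots> = ennreal (\<integral>x. exp (g x / \<tau>) / partition_function \<tau> g \<partial>L)"
    using Z i by (intro nn_integral_eq_integral) auto
  also have "(\<integral>x. exp (g x / \<tau>) / partition_function \<tau> g \<partial>L) = 1"
    using Z by (simp add: partition_function_def)
  finally show "emeasure (gibbs \<Omega> \<tau> g) (space (gibbs \<Omega> \<tau> g)) = 1" by simp
qed

section \<open>Laplace's method at a unique maximiser\<close>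

lemma maximum_gap:
  fixes g :: "'a \<Rightarrow> real"
  assumes g: "continuous_on \<Omega> g" and x: "x \<in> \<Omega>" and "0 < \<delta>"
    and unique: "\<And>y. y \<in> \<Omega> \<Longrightarrow> y \<noteq> x \<Longrightarrow> g y < g x"
  obtains \<eta> where "0 < \<eta>" "\<And>y. y \<in> \<Omega> \<Longrightarrow> y \<notin> ball x \<delta> \<Longrightarrow> g y \<le> g x - \<eta>"
proof (cases "\<Omega> - ball x \<delta> = {}")
  case True
  \<comment> \<open>The ball covers \<open>\<Omega>\<close>, so there is no point to bound and any
    positive gap serves.\<close>
  then show thesis by (intro that[of 1]) auto
next
  case False
  \<comment> \<open>What remains outside the open ball is compact, so \<open>g\<close> attains its
    maximum there at some \<open>z\<close>. As \<open>z\<close> differs from \<open>x\<close>, the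
    gap \<open>g x - g z\<close> is positive.\<close>
  have "compact (\<Omega> - ball x \<delta>)"
    using compact by (intro compact_diff) auto
  then obtain z where z: "z \<in> \<Omega> - ball x \<delta>" "\<And>y. y \<in> \<Omega> - ball x \<delta> \<Longrightarrow> g y \<le> g z"
    using continuous_attains_sup[OF _ False continuous_on_subset[OF g]] by blast
  have "g z < g x"
    using z(1) \<open>0 < \<delta>\<close> by (intro unique) auto
  then show thesis
    using z(2) by (intro that[of "g x - g z"]) auto
qed

text \<open>Split \<open>\<Omega>\<close> at a ball around \<open>x\<close>: inside,
  \<open>h\<close> is within \<open>\<epsilon>\<close> of \<open>h x\<close>; outside, the Gibbs
  density is exponentially small. Neither \<open>C\<close> nor \<open>\<eta>\<close> depends on
  \<open>\<tau>\<close>, which allows \<open>\<tau>\<close> to tend to 0 afterwards.\<close>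

lemma gibbs_integral_bound:
  fixes h :: "'a \<Rightarrow> real"
  assumes g: "continuous_on \<Omega> g" and h: "continuous_on \<Omega> h" and x: "x \<in> \<Omega>"
    and unique: "\<And>y. y \<in> \<Omega> \<Longrightarrow> y \<noteq> x \<Longrightarrow> g y < g x" and "0 < \<epsilon>"
  obtains C \<eta> where "0 < \<eta>"
    "\<And>\<tau>. 0 < \<tau> \<Longrightarrow> \<bar>(\<integral>y. h y \<partial>gibbs \<Omega> \<tau> g) - h x\<bar> \<le> \<epsilon> + C * exp (- \<eta> / \<tau>)"
proof -
  interpret finite_measure L by (rule finite_measure_L)
  obtain H where "0 < H" and H: "\<And>y. y \<in> \<Omega> \<Longrightarrow> \<bar>h y\<bar> \<le> H"
    using bounded_continuous[OF h] by blast
  obtain \<delta> where "0 < \<delta>" and \<delta>: "\<And>y. y \<in> \<Omega> \<Longrightarrow> dist y x < \<delta> \<Longrightarrow> dist (h y) (h x) < \<epsilon>"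
    using h x \<open>0 < \<epsilon>\<close> unfolding continuous_on_iff by blast
  obtain \<eta> where "0 < \<eta>" and \<eta>: "\<And>y. y \<in> \<Omega> \<Longrightarrow> y \<notin> ball x \<delta> \<Longrightarrow> g y \<le> g x - \<eta>"
    using maximum_gap[OF g x \<open>0 < \<delta>\<close> unique] by blast
  \<comment> \<open>The tolerance is half the gap: that much is lost in bounding the normalising
    constant from below, and the other half survives as the decay rate.\<close>
  obtain r where "0 < r" and r: "\<And>y. y \<in> \<Omega> \<Longrightarrow> dist y x < r \<Longrightarrow> dist (g y) (g x) < \<eta> / 2"
    using g x half_gt_zero[OF \<open>0 < \<eta>\<close>] unfolding continuous_on_iff by blast
  define v where "v = measure lborel (ball x r \<inter> \<Omega>)"
  have "0 < v" unfolding v_def by (rule volume[OF x \<open>0 < r\<close>])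
  define C where "C = 2 * H / v"
  have bound: "\<bar>(\<integral>y. h y \<partial>gibbs \<Omega> \<tau> g) - h x\<bar>
      \<le> \<epsilon> + C * measure L \<Omega> * exp (- (\<eta> / 2) / \<tau>)" if "0 < \<tau>" for \<tau>
  proof -
    define Z where "Z = partition_function \<tau> g"
    define p where "p y = exp (g y / \<tau>) / Z" for y
    have "0 < Z" unfolding Z_def by (rule partition_function_pos[OF g \<open>0 < \<tau>\<close>])
    have p: "continuous_on \<Omega> p"
      unfolding p_def divide_inverse[of _ Z]
      by (intro continuous_intros continuous_gibbs_weight g)
    have p_pos: "0 < p y" for y using \<open>0 < Z\<close> by (simp add: p_def)
    have p_int: "(\<integral>y. p y \<partial>L) = 1"
      using \<open>0 < Z\<close> by (simp add: p_def Z_def partition_function_def)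
    have "v * exp ((g x - \<eta> / 2) / \<tau>) \<le> Z"
      unfolding v_def Z_def
    proof (intro partition_function_lower_bound g \<open>0 < \<tau>\<close>)
      fix y assume "y \<in> ball x r \<inter> \<Omega>"
      then show "g x - \<eta> / 2 \<le> g y"
        using r[of y] abs_ge_self[of "g x - g y"] \<open>0 < \<eta>\<close>
        by (auto simp: dist_commute dist_real_def)
    qed
    then have Zinv: "1 / Z \<le> 1 / (v * exp ((g x - \<eta> / 2) / \<tau>))"
      using \<open>0 < v\<close> by (intro frac_le) auto
    \<comment> \<open>The numerator is at most \<open>exp ((g x - \<eta>) / \<tau>)\<close> and the
      normalising constant at least \<open>v * exp ((g x - \<eta> / 2) / \<tau>)\<close>, so the
      maximum value cancels in the quotient.\<close>
    have far: "p y \<le> exp (- (\<eta> / 2) / \<tau>) / v" if "y \<in> \<Omega>" "y \<notin> ball x \<delta>" for y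
    proof -
      have "p y = exp (g y / \<tau>) * (1 / Z)" by (simp add: p_def)
      also have "\<dots> \<le> exp ((g x - \<eta>) / \<tau>) * (1 / (v * exp ((g x - \<eta> / 2) / \<tau>)))"
        using \<eta>[OF that] \<open>0 < \<tau>\<close> Zinv \<open>0 < Z\<close>
        by (intro mult_mono) (auto simp: divide_right_mono)
      also have "\<dots> = exp ((g x - \<eta>) / \<tau> - (g x - \<eta> / 2) / \<tau>) / v"
        by (simp add: exp_diff)
      also have "(g x - \<eta>) / \<tau> - (g x - \<eta> / 2) / \<tau> = - (\<eta> / 2) / \<tau>"
        by (simp add: diff_divide_distrib)
      finally show ?thesis .
    qed
    \<comment> \<open>The near term keeps the weight \<open>p y\<close>, because \<open>p\<close>
      integrates to one and so contributes exactly \<open>\<epsilon>\<close>. The far term is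
      uniform, and the factor \<open>2 * H\<close> in \<open>C\<close> bounds the oscillation of
      \<open>h\<close>.\<close>
    have pointwise: "\<bar>p y * (h y - h x)\<bar> \<le> \<epsilon> * p y + C * exp (- (\<eta> / 2) / \<tau>)" if "y \<in> \<Omega>" for y
    proof (cases "y \<in> ball x \<delta>")
      case True
      then have "\<bar>h y - h x\<bar> \<le> \<epsilon>"
        using \<delta>[OF that] by (auto simp: dist_commute dist_real_def)
      then have "p y * \<bar>h y - h x\<bar> \<le> p y * \<epsilon>"
        using p_pos[of y] by (intro mult_left_mono) auto
      moreover have "0 \<le> C * exp (- (\<eta> / 2) / \<tau>)"
        using \<open>0 < H\<close> \<open>0 < v\<close> by (simp add: C_def)
      ultimately show ?thesis
        using abs_mult[of "p y" "h y - h x"] abs_of_pos[OF p_pos[of y]] mult.commute[of \<epsilon> "p y"]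
        by linarith
    next
      case False
      have "\<bar>h y - h x\<bar> \<le> 2 * H"
        using H[OF that] H[OF x] by linarith
      then have "p y * \<bar>h y - h x\<bar> \<le> exp (- (\<eta> / 2) / \<tau>) / v * (2 * H)"
        using p_pos[of y] far[OF that False] \<open>0 < v\<close> by (intro mult_mono) auto
      also have "\<dots> = C * exp (- (\<eta> / 2) / \<tau>)" by (simp add: C_def)
      finally show ?thesis
        using p_pos[of y] \<open>0 < \<epsilon>\<close> by (simp add: abs_mult add_increasing)
    qed
    have iph: "integrable L (\<lambda>y. p y * (h y - h x))" and ip: "integrable L p"
      and iph': "integrable L (\<lambda>y. p y * h y)"
      by (intro integrable_continuous_L continuous_intros p h)+
    have "(\<integral>y. h y \<partial>gibbs \<Omega> \<tau> g) = (\<integral>y. p y * h y \<partial>L)"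
      by (simp add: integral_gibbs[OF g \<open>0 < \<tau>\<close> h] p_def Z_def)
    \<comment> \<open>Since \<open>p\<close> has integral one, the constant \<open>h x\<close> can
      be moved under the integral.\<close>
    then have "(\<integral>y. h y \<partial>gibbs \<Omega> \<tau> g) - h x = (\<integral>y. p y * (h y - h x) \<partial>L)"
      using ip iph' p_int by (simp add: right_diff_distrib)
    also have "\<bar>\<dots>\<bar> \<le> (\<integral>y. \<bar>p y * (h y - h x)\<bar> \<partial>L)"
      by (rule integral_abs_bound)
    also have "\<dots> \<le> (\<integral>y. \<epsilon> * p y + C * exp (- (\<eta> / 2) / \<tau>) \<partial>L)"
      using ip iph pointwise by (intro integral_mono) auto
    also have "\<dots> = \<epsilon> + C * measure L \<Omega> * exp (- (\<eta> / 2) / \<tau>)"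
      using ip p_int by simp
    finally show ?thesis .
  qed
  show thesis
    by (rule that[of "\<eta> / 2" "C * measure L \<Omega>"]) (use bound \<open>0 < \<eta>\<close> in auto)
qed

lemma laplace_concentration:
  fixes h :: "'a \<Rightarrow> real"
  assumes g: "continuous_on \<Omega> g" and h: "continuous_on \<Omega> h" and x: "x \<in> \<Omega>"
    and unique: "\<And>y. y \<in> \<Omega> \<Longrightarrow> y \<noteq> x \<Longrightarrow> g y < g x"
  shows "((\<lambda>\<tau>. \<integral>y. h y \<partial>gibbs \<Omega> \<tau> g) \<longlongrightarrow> h x) (at_right 0)"
proof (rule tendstoI)
  fix e :: real assume "0 < e"
  obtain C \<eta> where "0 < \<eta>"
    and b: "\<And>\<tau>. 0 < \<tau> \<Longrightarrow> \<bar>(\<integral>y. h y \<partial>gibbs \<Omega> \<tau> g) - h x\<bar> \<le> e / 2 + C * exp (- \<eta> / \<tau>)"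
    using gibbs_integral_bound[OF g h x unique half_gt_zero[OF \<open>0 < e\<close>]] by blast
  have "filterlim (\<lambda>\<tau>. - \<eta> / \<tau>) at_bot (at_right 0)"
    using filterlim_tendsto_neg_mult_at_bot[OF tendsto_const _ filterlim_inverse_at_top_right, of "- \<eta>"]
      \<open>0 < \<eta>\<close> by (simp add: divide_inverse)
  \<comment> \<open>Nothing is known about the sign of \<open>C\<close>; the product tends to 0 in
    any case.\<close>
  then have "((\<lambda>\<tau>. C * exp (- \<eta> / \<tau>)) \<longlongrightarrow> C * 0) (at_right 0)"
    by (intro tendsto_mult tendsto_const filterlim_compose[OF exp_at_bot])
  then have "\<forall>\<^sub>F \<tau> in at_right 0. C * exp (- \<eta> / \<tau>) < e / 2"
    using \<open>0 < e\<close> by (intro order_tendstoD) auto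
  then show "\<forall>\<^sub>F \<tau> in at_right 0. dist (\<integral>y. h y \<partial>gibbs \<Omega> \<tau> g) (h x) < e"
    using eventually_at_right_less[of 0]
  proof eventually_elim
    case (elim \<tau>)
    show ?case using b[OF elim(2)] elim(1) unfolding dist_real_def by linarith
  qed
qed

end

section \<open>Measurability in the path\<close>

text \<open>This isolates the two properties of the path space that make the Gibbs kernel and the
  maximiser measurable; laws of paths are then points of \<open>prob_algebra S\<close>.\<close>

locale continuous_path_space = positive_volume_domain \<Omega>
  for \<Omega> :: "'a::euclidean_space set" +
  fixes S :: "('a \<Rightarrow> real) measure"
  assumes evaluation: "\<And>x. x \<in> \<Omega> \<Longrightarrow> (\<lambda>g. g x) \<in> borel_measurable S"
    and continuous: "\<And>g. g \<in> space S \<Longrightarrow> continuous_on \<Omega> g"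
begin

text \<open>A map measurable in \<open>g\<close> and continuous in \<open>x\<close> is jointly
  measurable: replace \<open>x\<close> by a nearby point of a countable dense set, chosen measurably
  in \<open>x\<close>, and let the distance tend to 0.\<close>

lemma joint_evaluation_measurable:
  "(\<lambda>(g, x). g x) \<in> borel_measurable (S \<Otimes>\<^sub>M L)"
proof -
  obtain D where D: "countable D" "D \<subseteq> \<Omega>" "\<Omega> \<subseteq> closure D"
    using separable[of \<Omega>] by blast
  then have "D \<noteq> {}" using nonempty by auto
  define d where "d = from_nat_into D"
  have d: "d k \<in> \<Omega>" for k
    using from_nat_into[OF \<open>D \<noteq> {}\<close>] D(2) unfolding d_def by auto
  have dense: "\<exists>k. dist (d k) x < e" if x: "x \<in> \<Omega>" "0 < e" for x e
  proof -
    obtain y where "y \<in> D" "dist y x < e"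
      using D(3) x unfolding closure_approachable subset_iff by meson
    then show ?thesis
      using from_nat_into_surj[OF D(1)] unfolding d_def by metis
  qed
  \<comment> \<open>Taking the first index within distance \<open>1 / real (Suc n)\<close> is a
    measurable choice, as it is determined by countably many distance inequalities in
    \<open>x\<close>.\<close>
  define a where "a n x = (LEAST k. dist (d k) x < 1 / real (Suc n))" for n x
  have a: "dist (d (a n x)) x < 1 / real (Suc n)" if "x \<in> \<Omega>" for n x
    unfolding a_def using dense[OF that] by (rule LeastI_ex) simp
  have [measurable]: "(\<lambda>x. x) \<in> L \<rightarrow>\<^sub>M borel"
    by (intro borel_measurable_continuous_L continuous_on_id)
  have [measurable]: "a n \<in> L \<rightarrow>\<^sub>M count_space UNIV" for n
    unfolding a_def by measurable
  show ?thesis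
  proof (rule borel_measurable_LIMSEQ_real)
    \<comment> \<open>The index takes countably many values, and for each of them the map is
      evaluation at a fixed point.\<close>
    show "(\<lambda>z. fst z (d (a n (snd z)))) \<in> borel_measurable (S \<Otimes>\<^sub>M L)" for n
    proof (rule measurable_compose_countable)
      show "(\<lambda>z. fst z (d k)) \<in> borel_measurable (S \<Otimes>\<^sub>M L)" for k
        by (rule measurable_compose[OF measurable_fst evaluation[OF d]])
    qed measurable
    fix z assume "z \<in> space (S \<Otimes>\<^sub>M L)"
    then obtain g x where z: "z = (g, x)" "g \<in> space S" "x \<in> \<Omega>"
      by (auto simp: space_pair_measure)
    have "(\<lambda>n. dist (d (a n x)) x) \<longlonglongrightarrow> 0"
      by (rule tendsto_sandwich[OF _ _ tendsto_const LIMSEQ_Suc[OF lim_1_over_n]])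
        (use a[OF z(3)] in \<open>auto intro!: always_eventually less_imp_le\<close>)
    then have "(\<lambda>n. d (a n x)) \<longlonglongrightarrow> x"
      by (subst tendsto_dist_iff)
    then have "(\<lambda>n. g (d (a n x))) \<longlonglongrightarrow> g x"
      by (rule continuous_on_tendsto_compose[OF continuous[OF z(2)] _ z(3)]) (simp add: d)
    then show "(\<lambda>n. fst z (d (a n (snd z)))) \<longlonglongrightarrow> (case z of (g, x) \<Rightarrow> g x)"
      by (simp add: z)
  qed
qed

text \<open>Joint measurability of evaluation makes integrals over \<open>\<Omega>\<close>
  measurable in the path. This applies first to the normalising constant and then to the mass of
  each set \<open>A\<close>.\<close>

lemma gibbs_measurable:
  assumes "0 < \<tau>"
  shows "gibbs \<Omega> \<tau> \<in> S \<rightarrow>\<^sub>M prob_algebra (restrict_space borel \<Omega>)"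
proof (rule measurable_prob_algebraI)
  interpret finite_measure L by (rule finite_measure_L)
  note joint_evaluation_measurable[measurable]
  show prob: "prob_space (gibbs \<Omega> \<tau> g)" if "g \<in> space S" for g
    by (rule prob_space_gibbs[OF continuous[OF that] \<open>0 < \<tau>\<close>])
  have weight [measurable]: "(\<lambda>(g, x). exp (g x / \<tau>)) \<in> borel_measurable (S \<Otimes>\<^sub>M L)"
    by measurable
  have Z [measurable]: "partition_function \<tau> \<in> borel_measurable S"
    unfolding partition_function_def[abs_def] by measurable
  show "gibbs \<Omega> \<tau> \<in> S \<rightarrow>\<^sub>M subprob_algebra (restrict_space borel \<Omega>)"
  proof (rule measurable_subprob_algebra)
    show "subprob_space (gibbs \<Omega> \<tau> g)" if "g \<in> space S" for g
      using prob[OF that] by (rule prob_space_imp_subprob_space)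
    fix A assume "A \<in> sets (restrict_space borel \<Omega>)"
    then have A [measurable]: "A \<in> sets L" by simp
    have "(\<lambda>g. \<integral>\<^sup>+x. ennreal (exp (g x / \<tau>) / partition_function \<tau> g) * indicator A x \<partial>L)
        \<in> borel_measurable S"
      by measurable
    moreover have "emeasure (gibbs \<Omega> \<tau> g) A
        = (\<integral>\<^sup>+x. ennreal (exp (g x / \<tau>) / partition_function \<tau> g) * indicator A x \<partial>L)"
      if "g \<in> space S" for g
    proof -
      have [measurable]: "(\<lambda>x. exp (g x / \<tau>)) \<in> borel_measurable L"
        by (intro borel_measurable_continuous_L continuous_gibbs_weight continuous that)
      show ?thesis
        unfolding gibbs_eq_density by (subst emeasure_density) (use A in auto)
    qed
    ultimately show "(\<lambda>g. emeasure (gibbs \<Omega> \<tau> g) A) \<in> borel_measurable S"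
      by (simp cong: measurable_cong)
  qed simp
qed

section \<open>Measurability of the maximiser\<close>

lemma maximum_attained_measurable:
  assumes "compact K" "K \<subseteq> \<Omega>"
  shows "Measurable.pred S (\<lambda>g. \<exists>x\<in>K. is_arg_max g (\<lambda>x. x \<in> \<Omega>) x)"
proof -
  obtain D where D: "countable D" "D \<subseteq> \<Omega>" "\<Omega> \<subseteq> closure D"
    using separable[of \<Omega>] by blast
  obtain E where E: "countable E" "E \<subseteq> K" "K \<subseteq> closure E"
    using separable[of K] by blast
  have clD: "closure D = \<Omega>"
    using D compact closure_minimal[OF D(2)] by (auto dest: compact_imp_closed)
  have clE: "closure E = K"
    using E assms(1) closure_minimal[OF E(2)] by (auto dest: compact_imp_closed)
  \<comment> \<open>For nonempty \<open>K\<close>, the maximum is attained in \<open>K\<close>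
    exactly when the supremum of \<open>g\<close> over \<open>E\<close> is at least that over
    \<open>D\<close>. The slack \<open>1 / real (Suc n)\<close> is there because the supremum over
    \<open>E\<close> may not be attained in \<open>E\<close>.\<close>
  have eq: "(\<exists>x\<in>K. is_arg_max g (\<lambda>x. x \<in> \<Omega>) x) \<longleftrightarrow>
      (\<forall>n::nat. \<forall>y\<in>D. \<exists>z\<in>E. g y - 1 / real (Suc n) < g z)" if g: "g \<in> space S" for g
  proof
    assume "\<exists>x\<in>K. is_arg_max g (\<lambda>x. x \<in> \<Omega>) x"
    then obtain x where x: "x \<in> K" "\<And>y. y \<in> \<Omega> \<Longrightarrow> g y \<le> g x"
      by (auto simp: is_arg_max_linorder)
    show "\<forall>n::nat. \<forall>y\<in>D. \<exists>z\<in>E. g y - 1 / real (Suc n) < g z"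
    proof (intro allI ballI, rule ccontr)
      fix n :: nat and y
      assume "y \<in> D" and "\<not> (\<exists>z\<in>E. g y - 1 / real (Suc n) < g z)"
      then have "\<And>z. z \<in> E \<Longrightarrow> g z \<le> g y - 1 / real (Suc n)" by force
      then have "g x \<le> g y - 1 / real (Suc n)"
        using continuous_on_subset[OF continuous[OF g] assms(2)] x(1)
          continuous_le_on_closure[of E g x "g y - 1 / real (Suc n)"]
        unfolding clE by blast
      moreover have "g y \<le> g x" using x(2) \<open>y \<in> D\<close> D(2) by blast
      moreover have "0 < 1 / real (Suc n)" by simp
      ultimately show False by linarith
    qed
  next
    assume *: "\<forall>n::nat. \<forall>y\<in>D. \<exists>z\<in>E. g y - 1 / real (Suc n) < g z"
    \<comment> \<open>A point of \<open>D\<close> forces a point of \<open>E\<close>, which rules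
      out an empty \<open>K\<close>, on which \<open>g\<close> has no maximum.\<close>
    have "D \<noteq> {}" using D(3) nonempty by auto
    then have "K \<noteq> {}" using * E(2) by blast
    then obtain x where x: "x \<in> K" "\<And>z. z \<in> K \<Longrightarrow> g z \<le> g x"
      using continuous_attains_sup[OF assms(1) _ continuous_on_subset[OF continuous[OF g] assms(2)]]
      by blast
    have "g y \<le> g x" if y: "y \<in> D" for y
    proof (rule field_le_epsilon)
      fix e :: real assume "0 < e"
      then obtain n where n: "1 / real (Suc n) < e"
        by (rule nat_approx_posE)
      obtain z where "z \<in> E" "g y - 1 / real (Suc n) < g z"
        using * y by blast
      then show "g y \<le> g x + e"
        using x(2)[of z] E(2) n by fastforce
    qed
    then have "g y \<le> g x" if "y \<in> \<Omega>" for y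
      using continuous[OF g] that continuous_le_on_closure[of D g y "g x"] unfolding clD by blast
    then show "\<exists>x\<in>K. is_arg_max g (\<lambda>x. x \<in> \<Omega>) x"
      using x(1) assms(2) by (auto simp: is_arg_max_linorder)
  qed
  have "Measurable.pred S (\<lambda>g. \<forall>n::nat. \<forall>y\<in>D. \<exists>z\<in>E. g y - 1 / real (Suc n) < g z)"
    unfolding pred_def
  proof (intro sets.sets_Collect_countable_All sets.sets_Collect_countable_All'
      sets.sets_Collect_countable_Ex' D(1) E(1))
    fix n :: nat and y z assume "y \<in> D" "z \<in> E"
    then have [measurable]: "(\<lambda>g. g y) \<in> borel_measurable S" "(\<lambda>g. g z) \<in> borel_measurable S"
      using D(2) E(2) assms(2) by (auto intro: evaluation)
    show "{g \<in> space S. g y - 1 / real (Suc n) < g z} \<in> sets S" by measurable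
  qed
  then show ?thesis
    by (subst measurable_cong[OF eq]) auto
qed

lemma arg_max_exists:
  assumes "g \<in> space S"
  shows "\<exists>x. is_arg_max g (\<lambda>x. x \<in> \<Omega>) x"
  using continuous_attains_sup[OF compact nonempty continuous[OF assms]]
  by (auto simp: is_arg_max_linorder)

lemma compact_halfspaces:
  "compact (\<Omega> \<inter> {x. x \<bullet> b \<le> c})" "compact (\<Omega> \<inter> {x. c \<le> x \<bullet> b})"
  by (intro compact_Int_closed compact closed_halfspace_component_le closed_halfspace_component_ge)+

text \<open>Two distinct maximisers are separated by a pair of rational coordinate half-spaces.\<close>

lemma unique_maximiser_measurable:
  "Measurable.pred S (\<lambda>g. \<exists>!x. is_arg_max g (\<lambda>x. x \<in> \<Omega>) x)"
proof -
  let ?lo = "\<lambda>g b c. \<exists>x\<in>\<Omega> \<inter> {x. x \<bullet> b \<le> c}. is_arg_max g (\<lambda>x. x \<in> \<Omega>) x"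
  let ?hi = "\<lambda>g b c. \<exists>x\<in>\<Omega> \<inter> {x. c \<le> x \<bullet> b}. is_arg_max g (\<lambda>x. x \<in> \<Omega>) x"
  have eq: "(\<exists>!x. is_arg_max g (\<lambda>x. x \<in> \<Omega>) x) \<longleftrightarrow>
      \<not> (\<exists>b\<in>Basis. \<exists>r s :: rat. r < s \<and> ?lo g b (of_rat r) \<and> ?hi g b (of_rat s))"
    if g: "g \<in> space S" for g
  proof
    assume "\<exists>!x. is_arg_max g (\<lambda>x. x \<in> \<Omega>) x"
    show "\<not> (\<exists>b\<in>Basis. \<exists>r s :: rat. r < s \<and> ?lo g b (of_rat r) \<and> ?hi g b (of_rat s))"
    proof
      assume "\<exists>b\<in>Basis. \<exists>r s :: rat. r < s \<and> ?lo g b (of_rat r) \<and> ?hi g b (of_rat s)"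
      then obtain b and r s :: rat and x y where "r < s" "x \<bullet> b \<le> of_rat r" "of_rat s \<le> y \<bullet> b"
        "is_arg_max g (\<lambda>x. x \<in> \<Omega>) x" "is_arg_max g (\<lambda>x. x \<in> \<Omega>) y"
        by blast
      moreover from this have "x = y"
        using \<open>\<exists>!x. is_arg_max g (\<lambda>x. x \<in> \<Omega>) x\<close> by blast
      moreover have "(of_rat r :: real) < of_rat s" using \<open>r < s\<close> by (simp add: of_rat_less)
      ultimately show False by simp
    qed
  next
    assume sep: "\<not> (\<exists>b\<in>Basis. \<exists>r s :: rat. r < s \<and> ?lo g b (of_rat r) \<and> ?hi g b (of_rat s))"
    have le: "y \<bullet> b \<le> x \<bullet> b" if "is_arg_max g (\<lambda>x. x \<in> \<Omega>) x" "is_arg_max g (\<lambda>x. x \<in> \<Omega>) y" "b \<in> Basis"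
      for x y b
    proof (rule ccontr)
      assume "\<not> y \<bullet> b \<le> x \<bullet> b"
      then obtain r where r: "x \<bullet> b < of_rat r" "of_rat r < y \<bullet> b"
        using of_rat_dense[of "x \<bullet> b" "y \<bullet> b"] by auto
      \<comment> \<open>A second rational strictly above the first makes the two closed half-spaces
        disjoint.\<close>
      then obtain s where s: "(of_rat r :: real) < of_rat s" "of_rat s < y \<bullet> b"
        using of_rat_dense[of "of_rat r" "y \<bullet> b"] by auto
      have "x \<in> \<Omega>" "y \<in> \<Omega>" using that by (auto simp: is_arg_max_linorder)
      then have "?lo g b (of_rat r)" "?hi g b (of_rat s)" "r < s"
        using that r s by (auto simp: of_rat_less intro: less_imp_le)
      then show False using sep that(3) by blast
    qed
    show "\<exists>!x. is_arg_max g (\<lambda>x. x \<in> \<Omega>) x"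
      \<comment> \<open>Existence comes from compactness; two maximisers agree in every coordinate
        because \<open>le\<close> applies to them in both orders.\<close>
      by (rule ex_ex1I[OF arg_max_exists[OF g]]) (rule euclidean_eqI, intro antisym le)
  qed
  \<comment> \<open>With the two attainment events abstracted to \<open>A\<close> and
    \<open>B\<close>, this is the complement of a union over the finite basis and countably many
    pairs of rationals.\<close>
  have separated: "Measurable.pred S (\<lambda>g. \<not> (\<exists>b\<in>Basis. \<exists>r s :: rat. r < s \<and> A b r g \<and> B b s g))"
    if [measurable]: "\<And>b r. Measurable.pred S (A b r)" "\<And>b s. Measurable.pred S (B b s)"
    for A B :: "'a \<Rightarrow> rat \<Rightarrow> ('a \<Rightarrow> real) \<Rightarrow> bool"
  proof (rule pred_intros_logic(2), rule pred_intros_finite(4)[OF finite_Basis])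
    show "Measurable.pred S (\<lambda>g. \<exists>r s :: rat. r < s \<and> A b r g \<and> B b s g)" for b
      by measurable
  qed
  have "Measurable.pred S (\<lambda>g. \<not> (\<exists>b\<in>Basis. \<exists>r s :: rat. r < s \<and> ?lo g b (of_rat r) \<and> ?hi g b (of_rat s)))"
    by (rule separated) (intro maximum_attained_measurable compact_halfspaces; auto)+
  then show ?thesis
    by (subst measurable_cong[OF eq]) auto
qed

text \<open>The maximiser is defined through a choice operator, whose value is forced once there is
  a single candidate.\<close>

lemma maximiser_unique:
  assumes "\<exists>!x. is_arg_max g (\<lambda>x. x \<in> \<Omega>) x" "is_arg_max g (\<lambda>x. x \<in> \<Omega>) x"
  shows "maximiser \<Omega> g = x"
  unfolding maximiser_def arg_max_on_def arg_max_def if_P[OF assms(1)]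
  using assms by (rule some1_equality)

text \<open>Coordinate half-spaces generate the Borel sets. Where the maximiser is unique, it lies
  in a half-space exactly when the maximum is attained there; elsewhere it is one constant point of
  \<open>\<Omega>\<close>.\<close>

lemma maximiser_measurable: "maximiser \<Omega> \<in> S \<rightarrow>\<^sub>M restrict_space borel \<Omega>"
proof (rule measurable_restrict_space2)
  have "maximiser \<Omega> g \<in> \<Omega>" for g
  proof (cases "\<exists>!x. is_arg_max g (\<lambda>x. x \<in> \<Omega>) x")
    case True
    then obtain x where "is_arg_max g (\<lambda>x. x \<in> \<Omega>) x" by blast
    with maximiser_unique[OF True this] show ?thesis by (simp add: is_arg_max_def)
  next
    case False
    then show ?thesis using nonempty by (simp add: maximiser_def some_in_eq)
  qed
  then show "maximiser \<Omega> \<in> space S \<rightarrow> \<Omega>" by auto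
  show "maximiser \<Omega> \<in> borel_measurable S"
    unfolding borel_measurable_iff_halfspace_le
  proof (intro ballI allI)
    fix b :: 'a and c :: real
    let ?unique = "\<lambda>g. \<exists>!x. is_arg_max g (\<lambda>x. x \<in> \<Omega>) x"
    let ?att = "\<lambda>g. \<exists>x\<in>\<Omega> \<inter> {x. x \<bullet> b \<le> c}. is_arg_max g (\<lambda>x. x \<in> \<Omega>) x"
    have eq: "maximiser \<Omega> g \<bullet> b \<le> c \<longleftrightarrow>
        (?unique g \<and> ?att g) \<or> (\<not> ?unique g \<and> (SOME x. x \<in> \<Omega>) \<bullet> b \<le> c)" for g
    proof (cases "?unique g")
      case True
      then obtain x where x: "is_arg_max g (\<lambda>x. x \<in> \<Omega>) x" by blast
      then have "x \<in> \<Omega>" by (simp add: is_arg_max_def)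
      then have "?att g \<longleftrightarrow> x \<bullet> b \<le> c"
        using True x by blast
      then show ?thesis
        unfolding maximiser_unique[OF True x] using True by blast
    next
      case False
      then show ?thesis by (simp add: maximiser_def)
    qed
    have [measurable]: "Measurable.pred S ?unique" "Measurable.pred S ?att"
      by (rule unique_maximiser_measurable, intro maximum_attained_measurable compact_halfspaces) auto
    show "{g \<in> space S. maximiser \<Omega> g \<bullet> b \<le> c} \<in> sets S"
      unfolding eq by measurable
  qed
qed

section \<open>Convergence of the annealed laws\<close>

text \<open>Stated for an arbitrary law on the path space, so that it can be applied to the
  posterior separately for each outcome.\<close>

theorem annealed_law_weak_conv:
  assumes N: "N \<in> space (prob_algebra S)"
    and unique: "AE g in N. \<exists>!x. is_arg_max g (\<lambda>x. x \<in> \<Omega>) x"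
  shows "weak_conv_on \<Omega> (\<lambda>\<tau>. annealed_law \<Omega> \<tau> N) (maximiser_law \<Omega> N) (at_right 0)"
proof -
  interpret N: prob_space N using N by (simp add: space_prob_algebra)
  have sets_N [measurable_cong]: "sets N = sets S" using N by (simp add: space_prob_algebra)
  have space_N: "space N = space S" using sets_N by (rule sets_eq_imp_space_eq)
  have gibbs: "gibbs \<Omega> \<tau> \<in> N \<rightarrow>\<^sub>M prob_algebra (restrict_space borel \<Omega>)" if "0 < \<tau>" for \<tau>
    using gibbs_measurable[OF that] by (simp cong: measurable_cong_sets add: sets_N)
  have max [measurable]: "maximiser \<Omega> \<in> N \<rightarrow>\<^sub>M restrict_space borel \<Omega>"
    using maximiser_measurable by (simp cong: measurable_cong_sets add: sets_N)
  have N': "N \<in> space (prob_algebra N)"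
    by (simp add: space_prob_algebra N.prob_space_axioms)
  have annealed: "annealed_law \<Omega> \<tau> N \<in> space (prob_algebra (restrict_space borel \<Omega>))" if "0 < \<tau>" for \<tau>
    using prob_space_bind'[OF N' gibbs[OF that]] sets_bind'[OF N' gibbs[OF that]]
    by (simp add: annealed_law_def space_prob_algebra)
  have lim: "((\<lambda>\<tau>. \<integral>x. h x \<partial>annealed_law \<Omega> \<tau> N) \<longlongrightarrow> (\<integral>x. h x \<partial>maximiser_law \<Omega> N)) (at_right 0)"
    if h: "continuous_on \<Omega> h" for h :: "'a \<Rightarrow> real"
  \<comment> \<open>Dominated convergence works along sequences, so the limit is tested on positive
    temperatures \<open>T n\<close> tending to 0; the upper end 1 is arbitrary.\<close>
  proof (rule tendsto_at_right_sequentially[of 0 1])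
    fix T :: "nat \<Rightarrow> real"
    assume T: "\<And>n. 0 < T n" "T \<longlonglongrightarrow> 0"
    obtain B where "0 < B" and B: "\<And>x. x \<in> \<Omega> \<Longrightarrow> \<bar>h x\<bar> \<le> B"
      using bounded_continuous[OF h] by blast
    have [measurable]: "h \<in> borel_measurable (restrict_space borel \<Omega>)"
      using h by (rule borel_measurable_continuous_on_restrict)
    have sub [measurable]: "gibbs \<Omega> (T n) \<in> N \<rightarrow>\<^sub>M subprob_algebra (restrict_space borel \<Omega>)" for n
      by (rule measurable_prob_algebraD[OF gibbs[OF T(1)]])
    have prob: "prob_space (gibbs \<Omega> (T n) g)" if "g \<in> space N" for g n
      using that by (intro prob_space_gibbs continuous T) (simp add: space_N)
    \<comment> \<open>Integration against a mixture is iterated integration; the bound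
      \<open>B\<close> on \<open>h\<close> and the unit mass of each Gibbs law justify it.\<close>
    have annealed_int: "(\<integral>x. h x \<partial>annealed_law \<Omega> (T n) N) = (\<integral>g. \<integral>x. h x \<partial>gibbs \<Omega> (T n) g \<partial>N)" for n
      unfolding annealed_law_def
    proof (rule integral_bind[OF _ _ sub N.finite_measure_axioms])
      show "AE g in N. emeasure (gibbs \<Omega> (T n) g) (space (gibbs \<Omega> (T n) g)) \<le> ennreal 1"
        using prob by (intro AE_I2) (simp add: prob_space.emeasure_space_1)
    qed (auto simp: space_restrict_space intro: B)
    have max_int: "(\<integral>x. h x \<partial>maximiser_law \<Omega> N) = (\<integral>g. h (maximiser \<Omega> g) \<partial>N)"
      unfolding maximiser_law_def by (rule integral_distr) measurable
    have "(\<lambda>n. \<integral>g. \<integral>x. h x \<partial>gibbs \<Omega> (T n) g \<partial>N) \<longlonglongrightarrow> (\<integral>g. h (maximiser \<Omega> g) \<partial>N)"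
    proof (rule integral_dominated_convergence[where w="\<lambda>_. B"])
      show "(\<lambda>g. h (maximiser \<Omega> g)) \<in> borel_measurable N" by measurable
      show "(\<lambda>g. \<integral>x. h x \<partial>gibbs \<Omega> (T n) g) \<in> borel_measurable N" for n
        by (rule measurable_compose[OF sub integral_measurable_subprob_algebra]) measurable
      show "AE g in N. (\<lambda>n. \<integral>x. h x \<partial>gibbs \<Omega> (T n) g) \<longlonglongrightarrow> h (maximiser \<Omega> g)"
        using unique AE_space
      proof eventually_elim
        case (elim g)
        obtain x where x: "is_arg_max g (\<lambda>x. x \<in> \<Omega>) x" using elim(1) by blast
        have "((\<lambda>\<tau>. \<integral>y. h y \<partial>gibbs \<Omega> \<tau> g) \<longlongrightarrow> h x) (at_right 0)"
        proof (rule laplace_concentration)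
          show "continuous_on \<Omega> g" using elim(2) by (intro continuous) (simp add: space_N)
          \<comment> \<open>A point \<open>y\<close> that ties with \<open>x\<close> would be a
            second maximiser, so uniqueness makes the inequality strict.\<close>
          show "g y < g x" if "y \<in> \<Omega>" "y \<noteq> x" for y
          proof (rule ccontr)
            assume "\<not> g y < g x"
            then have "is_arg_max g (\<lambda>x. x \<in> \<Omega>) y"
              using x that(1) unfolding is_arg_max_linorder by force
            then show False using elim(1) x that(2) by blast
          qed
        qed (use x h in \<open>auto simp: is_arg_max_def\<close>)
        moreover have "filterlim T (at_right 0) sequentially"
          using T(2) by (auto simp: filterlim_at T(1) less_imp_neq[OF T(1), symmetric])
        ultimately show ?case
          unfolding maximiser_unique[OF elim(1) x] by (rule filterlim_compose)
      qed
      \<comment> \<open>Gibbs laws are probability measures, so the integral of \<open>h\<close>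
        stays within \<open>B\<close>, a constant that is integrable under \<open>N\<close>.\<close>
      show "AE g in N. norm (\<integral>x. h x \<partial>gibbs \<Omega> (T n) g) \<le> B" for n
      proof (rule AE_I2)
        fix g assume "g \<in> space N"
        then interpret G: prob_space "gibbs \<Omega> (T n) g" by (rule prob)
        have "space (gibbs \<Omega> (T n) g) = \<Omega>"
          using sets_eq_imp_space_eq[OF sets_gibbs] by (simp add: space_restrict_space)
        then have bd: "AE x in gibbs \<Omega> (T n) g. norm (h x) \<le> B"
          using B by (intro AE_I2) auto
        then have int: "integrable (gibbs \<Omega> (T n) g) h"
          by (rule G.integrable_const_bound) measurable
        have "norm (\<integral>x. h x \<partial>gibbs \<Omega> (T n) g) \<le> (\<integral>x. norm (h x) \<partial>gibbs \<Omega> (T n) g)"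
          by (rule integral_norm_bound)
        also have "\<dots> \<le> B"
          using int bd by (intro G.integral_le_const) auto
        finally show "norm (\<integral>x. h x \<partial>gibbs \<Omega> (T n) g) \<le> B" .
      qed
    qed simp
    then show "(\<lambda>n. \<integral>x. h x \<partial>annealed_law \<Omega> (T n) N) \<longlonglongrightarrow> (\<integral>x. h x \<partial>maximiser_law \<Omega> N)"
      by (simp add: annealed_int max_int)
  qed simp
  have "maximiser_law \<Omega> N \<in> space (prob_algebra (restrict_space borel \<Omega>))"
    using N.prob_space_distr[OF max] by (simp add: maximiser_law_def space_prob_algebra)
  \<comment> \<open>The Gibbs kernel was treated for positive \<open>\<tau>\<close>, and these are
    the only values that the right-hand filter sees.\<close>
  moreover have "\<forall>\<^sub>F \<tau> in at_right 0. annealed_law \<Omega> \<tau> N \<in> space (prob_algebra (restrict_space borel \<Omega>))"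
    using eventually_at_right_less[of 0] by eventually_elim (rule annealed)
  ultimately show ?thesis
    using lim by (auto simp: weak_conv_on_def)
qed

end

section \<open>Application to the posterior laws\<close>

lemma positive_volume_domainI:
  fixes \<Omega> :: "'a::euclidean_space set"
  assumes "compact \<Omega>" "\<Omega> \<noteq> {}" and "0 < c" "0 < r0"
    and lower: "\<And>x r. x \<in> \<Omega> \<Longrightarrow> 0 < r \<Longrightarrow> r \<le> r0 \<Longrightarrow>
          c * r ^ DIM('a) \<le> measure lborel (ball x r \<inter> \<Omega>)"
  shows "positive_volume_domain \<Omega>"
proof
  fix x :: 'a and r :: real
  assume x: "x \<in> \<Omega>" and "0 < r"
  \<comment> \<open>The lower bound covers radii up to \<open>r0\<close>. A larger ball contains the
    one of radius \<open>s\<close>, so monotonicity of the volume carries positivity over.\<close>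
  define s where "s = min r r0"
  have s: "0 < s" "s \<le> r" "s \<le> r0" using \<open>0 < r\<close> \<open>0 < r0\<close> by (auto simp: s_def)
  have \<Omega>: "\<Omega> \<in> sets borel" using \<open>compact \<Omega>\<close> by (rule borel_compact)
  \<comment> \<open>The real-valued \<open>measure\<close> vanishes on sets of infinite mass, so its
    monotonicity requires finite volume, which boundedness of the ball supplies.\<close>
  have fin: "ball x r \<inter> \<Omega> \<in> fmeasurable lborel"
    using \<Omega> emeasure_bounded_finite[of "ball x r \<inter> \<Omega>"]
    by (intro fmeasurableI) (auto simp: bounded_Int)
  have "0 < c * s ^ DIM('a)" using \<open>0 < c\<close> s by simp
  also have "\<dots> \<le> measure lborel (ball x s \<inter> \<Omega>)" by (rule lower[OF x s(1) s(3)])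
  also have "\<dots> \<le> measure lborel (ball x r \<inter> \<Omega>)"
    using fin \<Omega> s by (intro measure_mono_fmeasurable) auto
  finally show "0 < measure lborel (ball x r \<inter> \<Omega>)" .
qed (use assms in auto)

lemma C1_on_imp_continuous_on: "C1_on U g \<Longrightarrow> continuous_on U g"
  unfolding C1_on_def gderiv_def
  by (auto intro!: continuous_at_imp_continuous_on dest: has_derivative_continuous)

text \<open>Evaluations generate the sigma-algebra of \<open>C1_paths U\<close>, and those at points
  of \<open>\<Omega>\<close> are among them; differentiability of the paths gives
  continuity.\<close>

lemma continuous_path_space_C1_paths:
  assumes "positive_volume_domain \<Omega>" "\<Omega> \<subseteq> U"
  shows "continuous_path_space \<Omega> (C1_paths U)"
proof -
  interpret positive_volume_domain \<Omega> by fact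
  show ?thesis
  proof
    fix x assume "x \<in> \<Omega>"
    then show "(\<lambda>g. g x) \<in> borel_measurable (C1_paths U)"
      using assms(2) unfolding C1_paths_def
      by (intro measurable_restrict_space1 measurable_component_singleton) auto
  next
    fix g assume "g \<in> space (C1_paths U)"
    then have "C1_on U g" by (simp add: C1_paths_def space_restrict_space)
    then show "continuous_on \<Omega> g"
      using assms(2) C1_on_imp_continuous_on continuous_on_subset by blast
  qed
qed

theorem proposition7:
  fixes M :: "'w measure"
    and \<Omega> U :: "'a::euclidean_space set"
    and \<kappa> :: "'a \<Rightarrow> 'a \<Rightarrow> real"
    and noise_var :: real
    and f :: "'w \<Rightarrow> 'a \<Rightarrow> real"
    and Df :: "'w \<Rightarrow> 'a \<Rightarrow> 'a"
    and noise :: "nat \<Rightarrow> 'w \<Rightarrow> real"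
    and R :: "nat \<Rightarrow> 'r measure"
    and xi :: "nat \<Rightarrow> 'w \<Rightarrow> 'r"
    and n0 t :: nat
    and q :: "nat \<Rightarrow> 'w \<Rightarrow> 'a"
    and draw :: "nat \<Rightarrow> 'w \<Rightarrow> 'a \<Rightarrow> real"
    and P :: "nat \<Rightarrow> 'w \<Rightarrow> ('a \<Rightarrow> real) measure"
  assumes "gp_sequential_design M \<Omega> U \<kappa> noise_var f Df noise R xi n0 q draw P"
  shows "AE w in M. weak_conv_on \<Omega> (\<lambda>\<tau>. annealed_law \<Omega> \<tau> (P t w))
           (maximiser_law \<Omega> (P t w)) (at_right 0)"
proof -
  interpret gp_sequential_design M \<Omega> U \<kappa> noise_var f Df noise R xi n0 q draw P by fact
  obtain c r0 where "0 < c" "0 < r0" "\<And>x r. x \<in> \<Omega> \<Longrightarrow> 0 < r \<Longrightarrow> r \<le> r0 \<Longrightarrow>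
      c * r ^ DIM('a) \<le> measure lborel (ball x r \<inter> \<Omega>)"
    using domain_volume by blast
  then have "positive_volume_domain \<Omega>"
    using domain interior_subset by (intro positive_volume_domainI[of \<Omega> c r0]) auto
  then interpret paths: continuous_path_space \<Omega> "C1_paths U"
    using U(2) by (rule continuous_path_space_C1_paths)
  show ?thesis
    using unique_maximiser[of t] AE_space
  proof eventually_elim
    case (elim w)
    \<comment> \<open>Measurability of the posterior kernel makes \<open>P t w\<close> a law on the
      continuously differentiable paths at every outcome; the exceptional null set stems from
      uniqueness of the maximiser alone.\<close>
    have "P t w \<in> space (prob_algebra (C1_paths U))"
      using measurable_space[OF posterior_kernel[of t]] elim(2)
      by (simp add: history_def)
    then show ?case using elim(1) by (rule paths.annealed_law_weak_conv)
  qed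
qed

end
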